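(* Let $H'\subseteq E\setminus H$. Then every pair $(s_i,t_i)$, $i\in[k]$, is $(p,q+1)$-flex-connected in $H\cup H'$ if and only if, for every violating edge set $F$, $H'$ is a feasible augmentation for $F$.
   Context: Let $G=(V,E)$ be an undirected graph whose edge set is partitioned into safe edges $\mathcal{S}$ and unsafe edges $\mathcal{U}$, and let $(s_i,t_i)$, $i\in[k]$, be terminal pairs. Vertices $s,t$ are $(p,q)$-flex-connected in an edge set $H$ if every cut $\delta_H(S)$ with $|S\cap\{s,t\}|=1$ contains at least $p$ safe edges or at least $p+q$ edges in total. Let $H\subseteq E$ be such that every pair $(s_i,t_i)$ is $(p,q)$-flex-connected in $H$. A violating edge set is a set $F=\delta_H(S)$ for some $S\subseteq V$ with $|S\cap\{s_i,t_i\}|=1$ for some $i$, such that $|\delta_H(S)|=p+q$ and at most $p-1$ edges of $\delta_H(S)$ are safe. A set $H'\subseteq E\setminus H$ is a feasible augmentation for a violating edge set $F$ if for each $i\in[k]$ there is a path from $s_i$ to $t_i$ in the graph with edge set $(H\cup H')\setminus F$. *)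

theory Defs
  imports Main
begin

text \<open>An undirected (multi)graph with vertex set V, edge set E (edges are abstract
objects so parallel edges are allowed) and an endpoint map ends.\<close>

definition ugraph :: "'v set \<Rightarrow> 'e set \<Rightarrow> ('e \<Rightarrow> 'v set) \<Rightarrow> bool" where
  "ugraph V E ends \<longleftrightarrow> finite V \<and> finite E \<and>
     (\<forall>e\<in>E. \<exists>u v. u \<in> V \<and> v \<in> V \<and> ends e = {u, v})"

text \<open>The cut \<delta>_H(S): edges of H with exactly one endpoint in S.\<close>
definition cut :: "('e \<Rightarrow> 'v set) \<Rightarrow> 'e set \<Rightarrow> 'v set \<Rightarrow> 'e set" where
  "cut ends H S = {e \<in> H. ends e \<inter> S \<noteq> {} \<and> ends e - S \<noteq> {}}"

text \<open>S separates s and t: exactly one of s, t lies in S.\<close>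
definition separates :: "'v set \<Rightarrow> 'v \<Rightarrow> 'v \<Rightarrow> bool" where
  "separates S s t \<longleftrightarrow> card (S \<inter> {s, t}) = 1"

text \<open>(p,q)-flex-connectivity of s,t in edge set H (Safe = safe edges).\<close>
definition flex_connected ::
  "'v set \<Rightarrow> ('e \<Rightarrow> 'v set) \<Rightarrow> 'e set \<Rightarrow> nat \<Rightarrow> nat \<Rightarrow> 'e set \<Rightarrow> 'v \<Rightarrow> 'v \<Rightarrow> bool" where
  "flex_connected V ends Safe p q H s t \<longleftrightarrow>
     (\<forall>S \<subseteq> V. separates S s t \<longrightarrow>
        card (cut ends H S \<inter> Safe) \<ge> p \<or> card (cut ends H S) \<ge> p + q)"

text \<open>Violating edge set for H with respect to terminal pairs term i, i < k.\<close>
definition violating ::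
  "'v set \<Rightarrow> ('e \<Rightarrow> 'v set) \<Rightarrow> 'e set \<Rightarrow> nat \<Rightarrow> nat \<Rightarrow> 'e set \<Rightarrow> nat \<Rightarrow> (nat \<Rightarrow> 'v \<times> 'v)
     \<Rightarrow> 'e set \<Rightarrow> bool" where
  "violating V ends Safe p q H k term F \<longleftrightarrow>
     (\<exists>S \<subseteq> V. F = cut ends H S \<and>
        (\<exists>i < k. separates S (fst (term i)) (snd (term i))) \<and>
        card (cut ends H S) = p + q \<and>
        card (cut ends H S \<inter> Safe) < p)"  (* "at most p-1 safe edges", integer reading *)

text \<open>Adjacency via edges of X; a path from s to t exists iff (s,t) is in its
reflexive transitive closure.\<close>
definition adj :: "('e \<Rightarrow> 'v set) \<Rightarrow> 'e set \<Rightarrow> ('v \<times> 'v) set" where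
  "adj ends X = {(u, v). \<exists>e \<in> X. ends e = {u, v}}"

definition connected_in :: "('e \<Rightarrow> 'v set) \<Rightarrow> 'e set \<Rightarrow> 'v \<Rightarrow> 'v \<Rightarrow> bool" where
  "connected_in ends X s t \<longleftrightarrow> (s, t) \<in> (adj ends X)\<^sup>*"

definition feasible_augmentation ::
  "('e \<Rightarrow> 'v set) \<Rightarrow> 'e set \<Rightarrow> nat \<Rightarrow> (nat \<Rightarrow> 'v \<times> 'v) \<Rightarrow> 'e set \<Rightarrow> 'e set \<Rightarrow> 'e set \<Rightarrow> bool" where
  "feasible_augmentation ends E k term H H' F \<longleftrightarrow>
     H' \<subseteq> E - H \<and>
     (\<forall>i < k. connected_in ends ((H \<union> H') - F) (fst (term i)) (snd (term i)))"

end

theory Submission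
  imports Defs
begin

text \<open>If \<open>H \<union> H'\<close> is \<open>(p, q + 1)\<close>-flex-connected and \<open>s\<^sub>i\<close>, \<open>t\<^sub>i\<close> were disconnected in
  \<open>(H \<union> H') - F\<close> for a violating set \<open>F\<close>, the component \<open>R\<close> of \<open>s\<^sub>i\<close> there would satisfy
  \<open>\<delta>\<^bsub>H \<union> H'\<^esub>(R) \<subseteq> F\<close>: a separating cut with at most \<open>p + q\<close> edges, fewer than \<open>p\<close> of
  them safe. Conversely, adding edges only enlarges cuts, so the only cuts of \<open>H \<union> H'\<close> that can
  fail \<open>(p, q + 1)\<close>-flex-connectivity are cuts \<open>\<delta>\<^sub>H(S)\<close> that are violating sets; an
  \<open>s\<^sub>i\<close>-\<open>t\<^sub>i\<close> path avoiding \<open>\<delta>\<^sub>H(S)\<close> crosses \<open>S\<close> through an edge of \<open>H'\<close>, so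
  \<open>\<delta>\<^bsub>H \<union> H'\<^esub>(S)\<close> has at least \<open>p + q + 1\<close> edges.\<close>

lemma separatesI: "(s \<in> S) \<noteq> (t \<in> S) \<Longrightarrow> separates S s t"
  unfolding separates_def by (cases "s \<in> S") (auto simp: Int_insert_right)

lemma separates_distinct_iff: "s \<noteq> t \<Longrightarrow> separates S s t \<longleftrightarrow> (s \<in> S) \<noteq> (t \<in> S)"
  unfolding separates_def by (cases "s \<in> S"; cases "t \<in> S") (auto simp: Int_insert_right)

lemma cut_subset: "cut ends H S \<subseteq> H"
  by (auto simp: cut_def)

lemma cut_mono: "H \<subseteq> H' \<Longrightarrow> cut ends H S \<subseteq> cut ends H' S"
  by (auto simp: cut_def)

lemma cut_Diff: "cut ends (H - F) S = cut ends H S - F"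
  by (auto simp: cut_def)

lemma finite_cut: "ugraph V E ends \<Longrightarrow> H \<subseteq> E \<Longrightarrow> finite (cut ends H S)"
  unfolding ugraph_def by (meson cut_subset finite_subset order_trans)

lemma cut_vertex_set_empty: "ugraph V E ends \<Longrightarrow> H \<subseteq> E \<Longrightarrow> cut ends H V = {}"
  unfolding ugraph_def cut_def by (auto dest!: subsetD)

lemma connected_in_cut_nonempty:
  assumes "connected_in ends X s t" and "(s \<in> S) \<noteq> (t \<in> S)"
  shows "cut ends X S \<noteq> {}"
  using assms unfolding connected_in_def
proof (induction rule: rtrancl_induct)
  case (step y z)
  show ?case
  proof (cases "(s \<in> S) \<noteq> (y \<in> S)")
    case False
    with step.prems have "(y \<in> S) \<noteq> (z \<in> S)" by blast
    moreover obtain e where "e \<in> X" "ends e = {y, z}"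
      using step.hyps(2) unfolding adj_def by blast
    ultimately have "e \<in> cut ends X S" unfolding cut_def by auto
    then show ?thesis by blast
  qed (use step.IH in blast)
qed simp

definition reach :: "'v set \<Rightarrow> ('e \<Rightarrow> 'v set) \<Rightarrow> 'e set \<Rightarrow> 'v \<Rightarrow> 'v set" where
  "reach V ends X s = {v \<in> V. connected_in ends X s v}"

lemma cut_reach_subset:
  assumes "ugraph V E ends" and "Y \<subseteq> E"
  shows "cut ends Y (reach V ends X s) \<subseteq> Y - X"
proof
  fix e assume e: "e \<in> cut ends Y (reach V ends X s)"
  then obtain u w where "u \<in> V" "w \<in> V" and ends: "ends e = {u, w}"
    using assms unfolding ugraph_def cut_def by blast
  with e have crossing: "u \<in> reach V ends X s \<and> w \<notin> reach V ends X s
      \<or> w \<in> reach V ends X s \<and> u \<notin> reach V ends X s"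
    unfolding cut_def by auto
  have "e \<notin> X"
  proof
    assume "e \<in> X"
    with ends have "(u, w) \<in> adj ends X" "(w, u) \<in> adj ends X"
      unfolding adj_def by (auto simp: insert_commute)
    with crossing \<open>u \<in> V\<close> \<open>w \<in> V\<close> show False
      unfolding reach_def connected_in_def by (auto intro: rtrancl_into_rtrancl)
  qed
  moreover have "e \<in> Y" using e unfolding cut_def by blast
  ultimately show "e \<in> Y - X" by blast
qed

lemma flex_connected_connected_in_Diff:
  assumes graph: "ugraph V E ends" and "Y \<subseteq> E" and "s \<in> V"
    and flex: "flex_connected V ends Safe p (q + 1) Y s t"
    and "finite F" and small: "card F \<le> p + q" and few_safe: "card (F \<inter> Safe) < p"
  shows "connected_in ends (Y - F) s t"
proof (rule ccontr)
  assume disconnected: "\<not> connected_in ends (Y - F) s t"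
  define R where "R = reach V ends (Y - F) s"
  have "s \<in> R" using \<open>s \<in> V\<close> unfolding R_def reach_def connected_in_def by simp
  moreover have "t \<notin> R" using disconnected unfolding R_def reach_def by simp
  ultimately have "separates R s t" by (intro separatesI) auto
  moreover have "R \<subseteq> V" unfolding R_def reach_def by blast
  ultimately have "p \<le> card (cut ends Y R \<inter> Safe) \<or> p + (q + 1) \<le> card (cut ends Y R)"
    using flex unfolding flex_connected_def by blast
  moreover have "cut ends Y R \<subseteq> F"
    using cut_reach_subset[OF graph \<open>Y \<subseteq> E\<close>] unfolding R_def by blast
  then have "card (cut ends Y R) \<le> card F" "card (cut ends Y R \<inter> Safe) \<le> card (F \<inter> Safe)"
    using \<open>finite F\<close> by (auto intro: card_mono)
  ultimately show False using small few_safe by linarith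
qed

lemma flex_connected_loop_imp_zero:
  assumes "ugraph V E ends" and "H \<subseteq> E" and "s \<in> V"
    and "flex_connected V ends Safe p q H s s"
  shows "p = 0"
proof -
  have "separates V s s" using \<open>s \<in> V\<close> unfolding separates_def by simp
  with assms show ?thesis
    unfolding flex_connected_def using cut_vertex_set_empty[OF assms(1,2)] by fastforce
qed

lemma flex_connected_Suc_if_tight_cuts_crossed:
  assumes graph: "ugraph V E ends" and "H \<subseteq> Y" "Y \<subseteq> E" and "s \<in> V"
    and flex: "flex_connected V ends Safe p q H s t"
    and crossed: "\<And>S. S \<subseteq> V \<Longrightarrow> separates S s t \<Longrightarrow> card (cut ends H S) = p + q \<Longrightarrow>
      card (cut ends H S \<inter> Safe) < p \<Longrightarrow> connected_in ends (Y - cut ends H S) s t"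
  shows "flex_connected V ends Safe p (q + 1) Y s t"
  unfolding flex_connected_def
proof (intro allI impI)
  fix S assume "S \<subseteq> V" and sep: "separates S s t"
  have fin: "finite (cut ends Y S)" using finite_cut[OF graph \<open>Y \<subseteq> E\<close>] .
  have sub: "cut ends H S \<subseteq> cut ends Y S" using cut_mono[OF \<open>H \<subseteq> Y\<close>] .
  have "p \<le> card (cut ends H S \<inter> Safe) \<or> p + q \<le> card (cut ends H S)"
    using flex \<open>S \<subseteq> V\<close> sep unfolding flex_connected_def by blast
  then consider (safe) "p \<le> card (cut ends H S \<inter> Safe)"
    | (large) "p + q < card (cut ends H S)"
    | (tight) "card (cut ends H S) = p + q" "card (cut ends H S \<inter> Safe) < p"
    by linarith
  then show "p \<le> card (cut ends Y S \<inter> Safe) \<or> p + (q + 1) \<le> card (cut ends Y S)"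
  proof cases
    case safe
    moreover have "card (cut ends H S \<inter> Safe) \<le> card (cut ends Y S \<inter> Safe)"
      using sub fin by (intro card_mono) auto
    ultimately show ?thesis by linarith
  next
    case large
    moreover have "card (cut ends H S) \<le> card (cut ends Y S)"
      using sub fin by (rule card_mono[rotated])
    ultimately show ?thesis by linarith
  next
    case tight
    \<comment> \<open>\<open>separates S s s\<close> holds for every \<open>S\<close> containing \<open>s\<close>, so pairs with \<open>s = t\<close> need care\<close>
    have "s \<noteq> t"
    proof
      assume "s = t"
      with flex have "p = 0"
        using flex_connected_loop_imp_zero[OF graph order_trans[OF \<open>H \<subseteq> Y\<close> \<open>Y \<subseteq> E\<close>] \<open>s \<in> V\<close>]
        by blast
      with tight(2) show False by simp
    qed
    with sep have "(s \<in> S) \<noteq> (t \<in> S)" by (simp add: separates_distinct_iff)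
    with crossed[OF \<open>S \<subseteq> V\<close> sep tight]
    have "cut ends (Y - cut ends H S) S \<noteq> {}" by (rule connected_in_cut_nonempty)
    then have "cut ends H S \<subset> cut ends Y S" using sub by (auto simp: cut_Diff)
    then have "card (cut ends H S) < card (cut ends Y S)"
      using fin by (rule psubset_card_mono[rotated])
    with tight(1) show ?thesis by linarith
  qed
qed

theorem claim4p1:
  fixes V :: "'v set" and E Safe H H' :: "'e set" and ends :: "'e \<Rightarrow> 'v set"
    and p q k :: nat and "term" :: "nat \<Rightarrow> 'v \<times> 'v"
  assumes graph: "ugraph V E ends"
    and safe: "Safe \<subseteq> E"
    and terms: "\<forall>i < k. fst (term i) \<in> V \<and> snd (term i) \<in> V"
    and H: "H \<subseteq> E"
    and flexH: "\<forall>i < k. flex_connected V ends Safe p q H (fst (term i)) (snd (term i))"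
    and H': "H' \<subseteq> E - H"
  shows "(\<forall>i < k. flex_connected V ends Safe p (q + 1) (H \<union> H') (fst (term i)) (snd (term i)))
     \<longleftrightarrow> (\<forall>F. violating V ends Safe p q H k term F \<longrightarrow>
              feasible_augmentation ends E k term H H' F)"
proof
  have HH': "H \<union> H' \<subseteq> E" using H H' by blast
  show "\<forall>F. violating V ends Safe p q H k term F \<longrightarrow> feasible_augmentation ends E k term H H' F"
    if flex: "\<forall>i < k. flex_connected V ends Safe p (q + 1) (H \<union> H') (fst (term i)) (snd (term i))"
  proof (intro allI impI)
    fix F assume "violating V ends Safe p q H k term F"
    then obtain S where F: "F = cut ends H S" "card F = p + q" "card (F \<inter> Safe) < p"
      unfolding violating_def by blast
    with finite_cut[OF graph H] have "finite F" by simp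
    show "feasible_augmentation ends E k term H H' F"
      unfolding feasible_augmentation_def
    proof (intro conjI allI impI)
      fix i assume "i < k"
      with terms flex have "fst (term i) \<in> V"
        "flex_connected V ends Safe p (q + 1) (H \<union> H') (fst (term i)) (snd (term i))"
        by auto
      then show "connected_in ends (H \<union> H' - F) (fst (term i)) (snd (term i))"
        by (rule flex_connected_connected_in_Diff[OF graph HH' _ _ \<open>finite F\<close>])
          (use F(2,3) in simp_all)
    qed (rule H')
  qed
  show "\<forall>i < k. flex_connected V ends Safe p (q + 1) (H \<union> H') (fst (term i)) (snd (term i))"
    if feasible: "\<forall>F. violating V ends Safe p q H k term F \<longrightarrow> feasible_augmentation ends E k term H H' F"
  proof (intro allI impI)
    fix i assume "i < k"
    have crossed: "connected_in ends (H \<union> H' - cut ends H S) (fst (term i)) (snd (term i))"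
      if "S \<subseteq> V" "separates S (fst (term i)) (snd (term i))" "card (cut ends H S) = p + q"
        "card (cut ends H S \<inter> Safe) < p" for S
      using feasible that \<open>i < k\<close> unfolding violating_def feasible_augmentation_def by blast
    from \<open>i < k\<close> terms flexH have "fst (term i) \<in> V"
      "flex_connected V ends Safe p q H (fst (term i)) (snd (term i))"
      by auto
    then show "flex_connected V ends Safe p (q + 1) (H \<union> H') (fst (term i)) (snd (term i))"
      by (rule flex_connected_Suc_if_tight_cuts_crossed[OF graph Un_upper1 HH' _ _ crossed])
  qed
qed

end
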